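(* Let $X$ be a Banach space, let $M$ be a nonempty closed subset of the unit sphere of $X$ such that $\operatorname{cone}(M)$ is convex, and let $f\colon X\to\mathbb{R}$. Let $\bar x\in X$ be a global minimum point of $f$ with respect to $M$ on $D_{\bar x}$, and suppose that $f$ is subhomogeneous with respect to $\bar x$ on $D_{\bar x}$. Then for every $t>0$ with $c_0(t)>0$, $$\frac{t}{2}\le r(c_0(t))\le t.$$
   Context: $\operatorname{cone}(M)=\{\lambda u\mid \lambda\ge 0,\ u\in M\}$ and $\operatorname{diam}(C)=\sup\{\|x-y\|\mid x,y\in C\}$. The minimal time function with respect to $M$ is $T_M(y,x):=\inf\{t\ge 0\mid x\in y+tM\}\in[0,\infty]$, with $\inf\emptyset=\infty$. For $x\in X$, $D_x:=\{z\in X\mid T_M(z,x)<\infty\}$. The point $\bar x$ is a global minimum point of $f$ with respect to $M$ on $D_{\bar x}$ if $f(\bar x)\le f(x)$ for all $x\in D_{\bar x}$. The function $f$ is subhomogeneous with respect to $\bar x$ on $D_{\bar x}$ if for every $x\in D_{\bar x}$, $f(sx+(1-s)\bar x)\le sf(x)+(1-s)f(\bar x)$ for all $s\in[0,1]$. For $\epsilon>0$, $\mathcal{L}(\bar x,\epsilon):=\{y\in D_{\bar x}\mid f(y)\le\inf_{x\in D_{\bar x}}f(x)+\epsilon\}$ and $r(\epsilon):=\tfrac12\operatorname{diam}(\mathcal{L}(\bar x,\epsilon))$. For $t\in[0,\infty)$, $c_0(t):=\inf\{f(x)-f(\bar x)\mid x\in D_{\bar x},\ T_M(x,\bar x)=t\}$.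 *)

theory Defs
  imports "HOL-Analysis.Analysis"
begin

text \<open>
  Infima, suprema and the quantities derived from them are taken in \<^typ>\<open>ereal\<close>, so that
  empty infima are \<open>\<infinity>\<close> and unbounded sets have infinite diameter.
\<close>

definition gen_cone :: "'a::real_vector set \<Rightarrow> 'a set" where
  "gen_cone M = {l *\<^sub>R u | l u. 0 \<le> l \<and> u \<in> M}"

lemma gen_cone_eq_cone_hull: "gen_cone M = cone hull M"
  unfolding gen_cone_def cone_hull_expl by simp

text \<open>Unlike \<^const>\<open>diameter\<close>, this is \<open>\<infinity>\<close> on unbounded sets.\<close>

definition ediam :: "'a::real_normed_vector set \<Rightarrow> ereal" where
  "ediam C = Sup {ereal (norm (x - y)) | x y. x \<in> C \<and> y \<in> C}"

definition min_time :: "'a::real_vector set \<Rightarrow> 'a \<Rightarrow> 'a \<Rightarrow> ereal" where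
  "min_time M y x = Inf {ereal t | t. 0 \<le> t \<and> x \<in> (\<lambda>m. y + t *\<^sub>R m) ` M}"

definition time_dom :: "'a::real_vector set \<Rightarrow> 'a \<Rightarrow> 'a set" where
  "time_dom M x = {z. min_time M z x < \<infinity>}"

definition global_min_point :: "('a::real_vector \<Rightarrow> real) \<Rightarrow> 'a set \<Rightarrow> 'a \<Rightarrow> bool" where
  "global_min_point f M xb \<longleftrightarrow> (\<forall>x\<in>time_dom M xb. f xb \<le> f x)"

definition subhomogeneous :: "('a::real_vector \<Rightarrow> real) \<Rightarrow> 'a set \<Rightarrow> 'a \<Rightarrow> bool" where
  "subhomogeneous f M xb \<longleftrightarrow>
    (\<forall>x\<in>time_dom M xb. \<forall>s\<in>{0..1}. f (s *\<^sub>R x + (1 - s) *\<^sub>R xb) \<le> s * f x + (1 - s) * f xb)"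

text \<open>
  The level \<open>\<epsilon>\<close> is an \<^typ>\<open>ereal\<close> so that the value of \<open>c0\<close> below can be used as a level directly.
\<close>

definition level_set :: "('a::real_vector \<Rightarrow> real) \<Rightarrow> 'a set \<Rightarrow> 'a \<Rightarrow> ereal \<Rightarrow> 'a set" where
  "level_set f M xb \<epsilon> =
    {y \<in> time_dom M xb. ereal (f y) \<le> (INF x\<in>time_dom M xb. ereal (f x)) + \<epsilon>}"

definition level_radius :: "('a::real_normed_vector \<Rightarrow> real) \<Rightarrow> 'a set \<Rightarrow> 'a \<Rightarrow> ereal \<Rightarrow> ereal" where
  "level_radius f M xb \<epsilon> = ediam (level_set f M xb \<epsilon>) / 2"

definition c0 :: "('a::real_vector \<Rightarrow> real) \<Rightarrow> 'a set \<Rightarrow> 'a \<Rightarrow> real \<Rightarrow> ereal" where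
  "c0 f M xb t = Inf {ereal (f x - f xb) | x. x \<in> time_dom M xb \<and> min_time M x xb = ereal t}"

end

theory Submission
  imports Defs
begin

text \<open>
  As \<open>M\<close> lies in the unit sphere, the time domain is \<open>xb - gen_cone M\<close> and the minimal time to
  \<open>xb\<close> is just the distance. Subhomogeneity makes \<open>f - f xb\<close> shrink at least linearly along each
  segment towards \<open>xb\<close>. Hence a point of the level set further than \<open>t\<close> from \<open>xb\<close> would yield
  a point at distance \<open>t\<close> where \<open>f - f xb\<close> is below its infimum \<open>c0 t\<close>. Conversely, pulling a
  nearly optimal point at distance \<open>t\<close> slightly towards \<open>xb\<close> moves it into the level set.
\<close>

text \<open>Vectors of \<open>M\<close> have norm 1, so comparing norms in
  \<open>t *\<^sub>R m = t' *\<^sub>R m'\<close> forces \<open>t' = t\<close>: the infimum is over a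
  singleton, even if several directions were allowed.\<close>

lemma min_time_ray:
  fixes M :: "'a::real_normed_vector set"
  assumes "M \<subseteq> sphere 0 1" "m \<in> M" "0 \<le> t"
  shows "min_time M (x - t *\<^sub>R m) x = ereal t"
proof -
  have "t' = t" if "0 \<le> t'" "m' \<in> M" "x = x - t *\<^sub>R m + t' *\<^sub>R m'" for t' m'
  proof -
    have "t *\<^sub>R m = t' *\<^sub>R m'" using that(3) by (simp add: algebra_simps)
    then have "norm (t *\<^sub>R m) = norm (t' *\<^sub>R m')" by simp
    moreover have "norm m = 1" "norm m' = 1" using assms(1,2) that(2) by auto
    ultimately show ?thesis using assms(3) that(1) by simp
  qed
  moreover have "x \<in> (\<lambda>m'. x - t *\<^sub>R m + t *\<^sub>R m') ` M"
    using assms(2) by (auto intro!: image_eqI[of _ _ m])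
  ultimately have "{ereal t' | t'. 0 \<le> t' \<and> x \<in> (\<lambda>m'. x - t *\<^sub>R m + t' *\<^sub>R m') ` M} = {ereal t}"
    using assms(3) by blast
  then show ?thesis by (simp add: min_time_def)
qed

lemma time_dom_eq: "time_dom M x = {x - t *\<^sub>R m | t m. 0 \<le> t \<and> m \<in> M}"
proof (intro equalityI subsetI)
  fix z assume "z \<in> time_dom M x"
  \<comment> \<open>An empty set of times would have infimum \<open>\<infinity>\<close>.\<close>
  then have "{ereal t | t. 0 \<le> t \<and> x \<in> (\<lambda>m. z + t *\<^sub>R m) ` M} \<noteq> {}"
    unfolding time_dom_def min_time_def by (force simp: top_ereal_def)
  then obtain t m where "0 \<le> t" "m \<in> M" "x = z + t *\<^sub>R m" by blast
  moreover from this have "z = x - t *\<^sub>R m" by simp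
  ultimately show "z \<in> {x - t *\<^sub>R m | t m. 0 \<le> t \<and> m \<in> M}" by blast
next
  fix z assume "z \<in> {x - t *\<^sub>R m | t m. 0 \<le> t \<and> m \<in> M}"
  then obtain t m where tm: "0 \<le> t" "m \<in> M" "z = x - t *\<^sub>R m" by blast
  then have "x \<in> (\<lambda>m. z + t *\<^sub>R m) ` M" by (intro image_eqI[of _ _ m]) auto
  with tm have "min_time M z x \<le> ereal t"
    unfolding min_time_def by (intro Inf_lower) blast
  then have "min_time M z x < \<infinity>" by (rule order_le_less_trans) simp
  then show "z \<in> time_dom M x" by (simp add: time_dom_def)
qed

text \<open>Replaces the constraint on the minimal time by a parametrization over directions, so
  that bounds on \<open>c0\<close> can be read off ray by ray.\<close>

lemma c0_eq_INF:
  fixes M :: "'a::real_normed_vector set"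
  assumes "M \<subseteq> sphere 0 1" "0 \<le> t"
  shows "c0 f M xb t = (INF m\<in>M. ereal (f (xb - t *\<^sub>R m) - f xb))"
proof -
  have "{ereal (f x - f xb) | x. x \<in> time_dom M xb \<and> min_time M x xb = ereal t}
      = (\<lambda>m. ereal (f (xb - t *\<^sub>R m) - f xb)) ` M"
    using assms by (fastforce simp: time_dom_eq min_time_ray)
  then show ?thesis by (simp add: c0_def)
qed

lemma center_in_time_dom: "M \<noteq> {} \<Longrightarrow> x \<in> time_dom M x"
  by (force simp: time_dom_eq)

text \<open>The center belongs to its own time domain (time 0), so the infimum of \<open>f\<close>
  there is attained at \<open>xb\<close>.\<close>

lemma level_set_eq:
  assumes "M \<noteq> {}" "global_min_point f M xb"
  shows "level_set f M xb (ereal c) = {y \<in> time_dom M xb. f y - f xb \<le> c}"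
proof -
  have "(INF x\<in>time_dom M xb. ereal (f x)) = ereal (f xb)"
    using assms center_in_time_dom
    by (intro antisym INF_lower INF_greatest) (auto simp: global_min_point_def)
  then show ?thesis by (auto simp: level_set_def)
qed

text \<open>The convex combination of \<open>xb - t *\<^sub>R m\<close> and \<open>xb\<close> with
  weight \<open>s\<close> stays on the same ray, at parameter \<open>s * t\<close>.\<close>

lemma subhomogeneous_ray:
  assumes "subhomogeneous f M xb" "m \<in> M" "0 \<le> t" "0 \<le> s" "s \<le> 1"
  shows "f (xb - (s * t) *\<^sub>R m) - f xb \<le> s * (f (xb - t *\<^sub>R m) - f xb)"
proof -
  have "xb - t *\<^sub>R m \<in> time_dom M xb" using assms(2,3) by (auto simp: time_dom_eq)
  moreover have "s *\<^sub>R (xb - t *\<^sub>R m) + (1 - s) *\<^sub>R xb = xb - (s * t) *\<^sub>R m"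
    by (simp add: algebra_simps)
  ultimately have "f (xb - (s * t) *\<^sub>R m) \<le> s * f (xb - t *\<^sub>R m) + (1 - s) * f xb"
    using assms(1,4,5) unfolding subhomogeneous_def by (metis atLeastAtMost_iff)
  then show ?thesis by (simp add: algebra_simps)
qed

theorem theorem5p1:
  fixes M :: "'a::banach set" and f :: "'a \<Rightarrow> real" and xb :: 'a
  assumes "M \<noteq> {}" and "closed M" and "M \<subseteq> sphere 0 1"
    and "convex (gen_cone M)"
    and "global_min_point f M xb"
    and "subhomogeneous f M xb"
  shows "\<forall>t::real. t > 0 \<and> c0 f M xb t > 0 \<longrightarrow>
    ereal (t / 2) \<le> level_radius f M xb (c0 f M xb t) \<and>
    level_radius f M xb (c0 f M xb t) \<le> ereal t"
proof (intro allI impI)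
  fix t :: real assume "t > 0 \<and> c0 f M xb t > 0"
  then have t: "0 < t" and c0_pos: "0 < c0 f M xb t" by auto
  have c0_INF: "c0 f M xb t = (INF m\<in>M. ereal (f (xb - t *\<^sub>R m) - f xb))"
    using assms(3) t by (intro c0_eq_INF) auto
  have c0_le: "c0 f M xb t \<le> ereal (f (xb - t *\<^sub>R m) - f xb)" if "m \<in> M" for m
    unfolding c0_INF using that by (rule INF_lower)
  obtain m0 where "m0 \<in> M" using assms(1) by blast
  \<comment> \<open>\<open>c0\<close> is finite: it is positive, and bounded above by the value
    along \<open>m0\<close>.\<close>
  then obtain c where c: "c0 f M xb t = ereal c"
    using c0_le[of m0] c0_pos by (cases "c0 f M xb t") auto
  have c_pos: "0 < c" using c0_pos c by simp
  define L where "L = level_set f M xb (ereal c)"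
  have L_eq: "L = {y \<in> time_dom M xb. f y - f xb \<le> c}"
    unfolding L_def using assms(1,5) by (rule level_set_eq)

  have norm_le: "norm (y - xb) \<le> t" if y: "y \<in> L" for y
  proof (rule ccontr)
    assume far: "\<not> norm (y - xb) \<le> t"
    obtain r m where rm: "0 \<le> r" "m \<in> M" "y = xb - r *\<^sub>R m"
      using y by (auto simp: L_eq time_dom_eq)
    have "norm m = 1" using assms(3) rm(2) by auto
    with far rm have r: "t < r" by simp
    have "c \<le> f (xb - t *\<^sub>R m) - f xb" using c0_le[OF rm(2)] c by simp
    \<comment> \<open>The point at distance \<open>t\<close> divides the segment from
      \<open>xb\<close> to \<open>y\<close> in the ratio \<open>t / r < 1\<close>.\<close>
    also have "\<dots> \<le> (t / r) * (f y - f xb)"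
      using subhomogeneous_ray[OF assms(6) rm(2,1), of "t / r"] r t rm(3) by simp
    also have "\<dots> \<le> (t / r) * c"
      using y r t by (intro mult_left_mono) (auto simp: L_eq)
    \<comment> \<open>Strictness needs both \<open>t < r\<close> and \<open>0 < c\<close>.\<close>
    also have "\<dots> < c" using r t c_pos by (simp add: field_simps)
    finally show False by simp
  qed
  have "ediam L \<le> ereal (2 * t)"
    unfolding ediam_def
  proof (rule Sup_least)
    fix d assume "d \<in> {ereal (norm (x - y)) | x y. x \<in> L \<and> y \<in> L}"
    then obtain x y where "d = ereal (norm (x - y))" "x \<in> L" "y \<in> L" by blast
    then show "d \<le> ereal (2 * t)"
      using norm_le[of x] norm_le[of y] norm_triangle_ineq4[of "x - xb" "y - xb"] by simp
  qed
  then have upper: "ediam L / 2 \<le> ereal t"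
    by (simp add: ereal_divide_le_pos)

  have near: "ereal (s * t) \<le> ediam L" if s: "0 < s" "s < 1" for s
  proof -
    \<comment> \<open>The infimum over \<open>M\<close> need not be attained. As
      \<open>c > 0\<close> and \<open>s < 1\<close>, the bound \<open>c / s\<close> lies strictly
      above it, and contracting by \<open>s\<close> brings the value back to at most
      \<open>c\<close>.\<close>
    have "c0 f M xb t < ereal (c / s)" using c c_pos s by (simp add: field_simps)
    then obtain m where m: "m \<in> M" "f (xb - t *\<^sub>R m) - f xb < c / s"
      unfolding c0_INF by (auto simp: INF_less_iff)
    have "f (xb - (s * t) *\<^sub>R m) - f xb \<le> s * (f (xb - t *\<^sub>R m) - f xb)"
      using subhomogeneous_ray[OF assms(6) m(1)] s t by simp
    also have "\<dots> \<le> c" using m(2) s by (simp add: field_simps)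
    finally have "xb - (s * t) *\<^sub>R m \<in> L" using m(1) s t by (force simp: L_eq time_dom_eq)
    moreover have "xb \<in> L" using center_in_time_dom[OF assms(1)] c_pos by (simp add: L_eq)
    moreover have "norm (xb - (xb - (s * t) *\<^sub>R m)) = s * t"
      using assms(3) m(1) s t by auto
    ultimately show ?thesis unfolding ediam_def by (intro Sup_upper) force
  qed
  have "ereal t \<le> ediam L"
  \<comment> \<open>Since \<open>near\<close> requires \<open>s < 1\<close>, the value
    \<open>t\<close> is only approached from below.\<close>
  proof (rule dense_le)
    fix u assume "u < ereal t"
    \<comment> \<open>The maximum with 0 makes \<open>v\<close> positive, so \<open>v / t\<close>
      lies strictly between 0 and 1.\<close>
    then obtain v where v: "max u 0 < ereal v" "v < t"
      using t ereal_dense2[of "max u 0" "ereal t"] by auto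
    then have "ereal v \<le> ediam L" using near[of "v / t"] t by (auto simp: field_simps)
    with v show "u \<le> ediam L" by (meson less_imp_le max.strict_boundedE order_trans)
  qed
  then have lower: "ereal (t / 2) \<le> ediam L / 2"
    by (simp add: ereal_le_divide_pos)
  show "ereal (t / 2) \<le> level_radius f M xb (c0 f M xb t) \<and>
      level_radius f M xb (c0 f M xb t) \<le> ereal t"
    using lower upper by (simp add: level_radius_def c L_def)
qed

end
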